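(* Let $b\ge 2$ be an integer, let $T=(t_1,\ldots,t_b)$ be a $b$-tuple of positive integers, and let $w_T(n|z_1,\ldots,z_b)$, $n\ge 0$, be the base $b$ Stern polynomials. Then, as formal power series in $t$ with coefficients in $\mathbb{Z}[z_1,\ldots,z_b]$, $$\sum_{n=1}^\infty w_T(n|z_1,\ldots,z_b)\, t^{n}= t\prod_{i=0}^\infty \left(1+\sum_{j=1}^b z_j^{t_j^i}\,t^{j\cdot b^i}\right).$$
   Context: Fix an integer $b\ge 2$ and a tuple $T=(t_1,\ldots,t_b)$ of positive integers. The base $b$ Stern polynomials $w_T(n|z_1,\ldots,z_b)\in\mathbb{Z}[z_1,\ldots,z_b]$ are defined by $w_T(0|z_1,\ldots,z_b)=0$, $w_T(1|z_1,\ldots,z_b)=1$, and for $n\ge 1$ by $$w_T(b(n-1)+j+1|z_1,\ldots,z_b)=z_j\,w_T(n|z_1^{t_1},\ldots,z_b^{t_b})\quad(1\le j\le b-1),$$ $$w_T(bn+1|z_1,\ldots,z_b)=z_b\,w_T(n|z_1^{t_1},\ldots,z_b^{t_b})+w_T(n+1|z_1^{t_1},\ldots,z_b^{t_b}).$$ Here $z_j^{t_j^i}$ means $z_j$ raised to the power $(t_j)^i$, with $(t_j)^0=1$; the variable $t$ is unrelated to the integers $t_j$. *)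

theory Defs
  imports
    "HOL-Analysis.Analysis"
    "HOL-Computational_Algebra.Formal_Power_Series"
    "HOL-Library.Poly_Mapping"
begin

text \<open>Integer polynomials in indeterminates indexed by the natural numbers, as the monoid
  algebra of the exponent vectors. The polynomials of interest involve only the indeterminates
  with index in \<open>{1..b}\<close>, see \<open>stern_mem_zpoly_on\<close> below.\<close>

type_synonym zpoly = "(nat \<Rightarrow>\<^sub>0 nat) \<Rightarrow>\<^sub>0 int"

definition zvar :: "nat \<Rightarrow> zpoly" where
  "zvar j = Poly_Mapping.single (Poly_Mapping.single j 1) 1"

definition zpoly_subst :: "(nat \<Rightarrow> zpoly) \<Rightarrow> zpoly \<Rightarrow> zpoly" where
  "zpoly_subst g p =
     (\<Sum>m\<in>Poly_Mapping.keys p. of_int (Poly_Mapping.lookup p m) *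
        (\<Prod>j\<in>Poly_Mapping.keys m. g j ^ Poly_Mapping.lookup m j))"

definition zpoly_on :: "nat set \<Rightarrow> zpoly set" where
  "zpoly_on V = {p. \<forall>m\<in>Poly_Mapping.keys p. Poly_Mapping.keys m \<subseteq> V}"

text \<open>The last equation only makes the function total: there is no Stern polynomial for
  base \<open>b < 2\<close>. Only the values of \<open>t\<close> on \<open>{1..b}\<close> are relevant.\<close>

function stern :: "nat \<Rightarrow> (nat \<Rightarrow> nat) \<Rightarrow> nat \<Rightarrow> zpoly" where
  "stern b t 0 = 0"
| "stern b t (Suc 0) = 1"
| "2 \<le> b \<Longrightarrow> 1 \<le> n \<Longrightarrow> 1 \<le> j \<Longrightarrow> j \<le> b - 1 \<Longrightarrow>
     stern b t (b * (n - 1) + j + 1) = zvar j * zpoly_subst (\<lambda>k. zvar k ^ t k) (stern b t n)"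
| "2 \<le> b \<Longrightarrow> 1 \<le> n \<Longrightarrow>
     stern b t (b * n + 1) =
       zvar b * zpoly_subst (\<lambda>k. zvar k ^ t k) (stern b t n)
       + zpoly_subst (\<lambda>k. zvar k ^ t k) (stern b t (n + 1))"
| "b < 2 \<Longrightarrow> 2 \<le> n \<Longrightarrow> stern b t n = 0"
proof -
  fix P :: bool and x :: "nat \<times> (nat \<Rightarrow> nat) \<times> nat"
  assume 0: "\<And>b t. x = (b, t, 0) \<Longrightarrow> P"
    and 1: "\<And>b t. x = (b, t, Suc 0) \<Longrightarrow> P"
    and 2: "\<And>b n j t. 2 \<le> b \<Longrightarrow> 1 \<le> n \<Longrightarrow> 1 \<le> j \<Longrightarrow> j \<le> b - 1 \<Longrightarrow>
              x = (b, t, b * (n - 1) + j + 1) \<Longrightarrow> P"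
    and 3: "\<And>b n t. 2 \<le> b \<Longrightarrow> 1 \<le> n \<Longrightarrow> x = (b, t, b * n + 1) \<Longrightarrow> P"
    and 4: "\<And>b n t. b < 2 \<Longrightarrow> 2 \<le> n \<Longrightarrow> x = (b, t, n) \<Longrightarrow> P"
  obtain b t m where x: "x = (b, t, m)" by (cases x) auto
  consider "m = 0" | "m = Suc 0" | "b < 2" "2 \<le> m" | "2 \<le> b" "2 \<le> m" by linarith
  then show P
  proof cases
    case 4
    define q r where "q = (m - 2) div b" and "r = (m - 2) mod b"
    have m: "m = b * q + r + 2"
      using mult_div_mod_eq[of b "m - 2"] \<open>2 \<le> m\<close> unfolding q_def r_def by linarith
    have r: "r < b" using \<open>2 \<le> b\<close> by (simp add: r_def)
    show P
    proof (cases "r = b - 1")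
      case True
      then have "x = (b, t, b * (q + 1) + 1)" using x m \<open>2 \<le> b\<close> by simp
      then show P using 3[of b "q + 1" t] \<open>2 \<le> b\<close> by simp
    next
      case False
      then have "r + 1 \<le> b - 1" using r by simp
      moreover have "x = (b, t, b * (q + 1 - 1) + (r + 1) + 1)" using x m by simp
      ultimately show P using 2[of b "q + 1" "r + 1" t] \<open>2 \<le> b\<close> by simp
    qed
  qed (use x 0 1 4 in blast)+
next
  fix b n j b' n' j' :: nat and t t' :: "nat \<Rightarrow> nat"
  assume A: "2 \<le> b" "1 \<le> n" "1 \<le> j" "j \<le> b - 1" "2 \<le> b'" "1 \<le> n'" "1 \<le> j'" "j' \<le> b' - 1"
    and eq: "(b, t, b * (n - 1) + j + 1) = (b', t', b' * (n' - 1) + j' + 1)"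
  have b: "b' = b" "t' = t" and e: "b * (n - 1) + j = b * (n' - 1) + j'" using eq by auto
  have lt: "j < b" "j' < b" using A b by auto
  have "n - 1 = (b * (n - 1) + j) div b" using lt by simp
  also have "\<dots> = n' - 1" unfolding e using lt by simp
  finally have n: "n = n'" using A by linarith
  with e have "j = j'" by simp
  with n b show "zvar j * zpoly_subst (\<lambda>k. zvar k ^ t k) (stern_sumC (b, t, n)) =
     zvar j' * zpoly_subst (\<lambda>k. zvar k ^ t' k) (stern_sumC (b', t', n'))" by simp
next
  fix b n j b' n' :: nat and t t' :: "nat \<Rightarrow> nat"
  assume A: "2 \<le> b" "1 \<le> n" "1 \<le> j" "j \<le> b - 1" "2 \<le> b'" "1 \<le> n'"
    and eq: "(b, t, b * (n - 1) + j + 1) = (b', t', b' * n' + 1)"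
  have b: "b' = b" and e: "b * (n - 1) + j = b * n'" using eq by auto
  have "j < b" using A by auto
  then have "j = (b * (n - 1) + j) mod b" by simp
  also have "\<dots> = 0" unfolding e by simp
  finally have False using A by simp
  then show "zvar j * zpoly_subst (\<lambda>k. zvar k ^ t k) (stern_sumC (b, t, n)) =
     zvar b' * zpoly_subst (\<lambda>k. zvar k ^ t' k) (stern_sumC (b', t', n'))
     + zpoly_subst (\<lambda>k. zvar k ^ t' k) (stern_sumC (b', t', n' + 1))" ..
qed auto

termination stern
proof (relation "Wellfounded.measure (\<lambda>(b, t, n). n)")
  fix b n j :: nat and t :: "nat \<Rightarrow> nat"
  assume A: "2 \<le> b" "1 \<le> n" "1 \<le> j" "j \<le> b - 1"
  then have "1 * (n - 1) \<le> b * (n - 1)" by (intro mult_le_mono1) simp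
  with A have "n < b * (n - 1) + j + 1" by linarith
  then show "((b, t, n), (b, t, b * (n - 1) + j + 1)) \<in> Wellfounded.measure (\<lambda>(b, t, n). n)"
    by (simp only: in_measure prod.case)
next
  fix b n :: nat and t :: "nat \<Rightarrow> nat"
  assume A: "2 \<le> b" "1 \<le> n"
  then have "2 * n \<le> b * n" by (intro mult_le_mono1)
  with A have "n < b * n + 1" "n + 1 < b * n + 1" by linarith+
  then show "((b, t, n), (b, t, b * n + 1)) \<in> Wellfounded.measure (\<lambda>(b, t, n). n)"
    and "((b, t, n + 1), (b, t, b * n + 1)) \<in> Wellfounded.measure (\<lambda>(b, t, n). n)"
    by (simp_all only: in_measure prod.case)
qed simp

lemma zpoly_on_0: "0 \<in> zpoly_on V"
  by (simp add: zpoly_on_def)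

lemma zpoly_on_single: "Poly_Mapping.keys m \<subseteq> V \<Longrightarrow> Poly_Mapping.single m c \<in> zpoly_on V"
  by (auto simp: zpoly_on_def)

lemma zpoly_on_1: "1 \<in> zpoly_on V"
  unfolding single_one[symmetric] by (rule zpoly_on_single) simp

lemma zpoly_on_of_int: "of_int c \<in> zpoly_on V"
proof -
  have "(of_int c :: zpoly) = Poly_Mapping.single 0 c"
    by (induction c rule: int_of_nat_induct)
       (simp_all add: single_of_nat single_uminus single_diff del: of_nat_Suc)
  then show ?thesis by (simp add: zpoly_on_single)
qed

lemma zpoly_on_zvar: "j \<in> V \<Longrightarrow> zvar j \<in> zpoly_on V"
  unfolding zvar_def by (rule zpoly_on_single) simp

lemma zpoly_on_add: "p \<in> zpoly_on V \<Longrightarrow> q \<in> zpoly_on V \<Longrightarrow> p + q \<in> zpoly_on V"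
  unfolding zpoly_on_def using Poly_Mapping.keys_add[of p q] by blast

lemma zpoly_on_mult:
  assumes "p \<in> zpoly_on V" "q \<in> zpoly_on V"
  shows "p * q \<in> zpoly_on V"
  unfolding zpoly_on_def
proof safe
  fix m k
  assume "m \<in> Poly_Mapping.keys (p * q)" and k: "k \<in> Poly_Mapping.keys m"
  then obtain u v where "m = u + v" "u \<in> Poly_Mapping.keys p" "v \<in> Poly_Mapping.keys q"
    using keys_mult[of p q] by blast
  with k assms Poly_Mapping.keys_add[of u v] show "k \<in> V"
    unfolding zpoly_on_def by blast
qed

lemma zpoly_on_power: "p \<in> zpoly_on V \<Longrightarrow> p ^ n \<in> zpoly_on V"
  by (induction n) (simp_all add: zpoly_on_1 zpoly_on_mult)

lemma zpoly_on_sum: "(\<And>x. x \<in> A \<Longrightarrow> f x \<in> zpoly_on V) \<Longrightarrow> sum f A \<in> zpoly_on V"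
  by (induction A rule: infinite_finite_induct) (simp_all add: zpoly_on_0 zpoly_on_add)

lemma zpoly_on_prod: "(\<And>x. x \<in> A \<Longrightarrow> f x \<in> zpoly_on V) \<Longrightarrow> prod f A \<in> zpoly_on V"
  by (induction A rule: infinite_finite_induct) (simp_all add: zpoly_on_1 zpoly_on_mult)

lemma zpoly_on_subst:
  assumes "p \<in> zpoly_on V" "\<And>j. j \<in> V \<Longrightarrow> g j \<in> zpoly_on V"
  shows "zpoly_subst g p \<in> zpoly_on V"
  unfolding zpoly_subst_def
  using assms
  by (intro zpoly_on_sum zpoly_on_mult zpoly_on_of_int zpoly_on_prod zpoly_on_power)
     (auto simp: zpoly_on_def)

lemma stern_mem_zpoly_on: "stern b t n \<in> zpoly_on {1..b}"
proof (induction b t n rule: stern.induct)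
  case (3 b n j t)
  then show ?case
    by (subst stern.simps(3))
       (auto intro!: zpoly_on_mult zpoly_on_zvar zpoly_on_subst zpoly_on_power)
next
  case (4 b n t)
  then show ?case
    by (subst stern.simps(4))
       (auto intro!: zpoly_on_add zpoly_on_mult zpoly_on_zvar zpoly_on_subst zpoly_on_power)
qed (simp_all add: zpoly_on_0 zpoly_on_1)

end

theory Submission
  imports Defs
begin

text \<open>
  Write \<open>\<phi>\<close> for the substitution \<open>z\<^sub>j \<mapsto> z\<^sub>j ^ t\<^sub>j\<close>, a ring endomorphism of the polynomial ring, and
  \<open>S i\<close> for the series \<open>\<Sum>n. (\<phi> ^^ i) (w (n + 1)) X ^ n\<close>. A number \<open>n\<close> is uniquely
  \<open>b q + r\<close> with \<open>r < b\<close>, and the recursion expresses \<open>w (n + 1)\<close> through \<open>\<phi> (w (q + 1))\<close> and,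
  if \<open>r = 0\<close>, also \<open>\<phi> (w q)\<close>. This says exactly that
  \<open>S i = A i * (S (i + 1) \<circ> X ^ b)\<close> with \<open>A i = 1 + (\<Sum>j = 1..b. z\<^sub>j ^ (t\<^sub>j ^ i) X ^ j)\<close>, since the
  coefficient of \<open>X ^ (b q + r)\<close> on the right meets only the summand \<open>j = r\<close> of \<open>A i\<close>,
  and for \<open>r = 0\<close> the two summands \<open>1\<close> and \<open>j = b\<close> (lemma \<open>stern_series_step\<close>).

  Iterating \<open>N\<close> times and using \<open>A i \<circ> X ^ (b ^ i) = F i\<close>, the \<open>i\<close>-th factor of the product, gives
  \<open>S 0 = F 0 * \<dots> * F (N - 1) * (S N \<circ> X ^ (b ^ N))\<close> (lemma \<open>stern_series_unfold\<close>). The last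
  factor is \<open>1\<close> up to terms of degree at least \<open>b ^ N\<close>, so the partial products agree with \<open>S 0\<close>
  in ever more coefficients, that is, they converge to it.
\<close>

section \<open>Substitution is a ring homomorphism\<close>

lemma frag_cmul_conv_of_int: "frag_cmul c p = of_int c * (p :: zpoly)"
proof (induction c rule: int_induct[where k = 0])
  case base
  show ?case by simp
next
  case (step1 i)
  then show ?case by (simp add: frag_cmul_distrib algebra_simps)
next
  case (step2 i)
  then show ?case by (simp add: frag_cmul_diff_distrib algebra_simps)
qed

text \<open>Integer polynomials are the free abelian group over the exponent vectors, and substitution is
  the additive extension of its values on monomials. This view provides additivity, and induction
  over monomials and differences.\<close>

lemma zpoly_subst_eq_frag_extend:
  "zpoly_subst g =
     frag_extend (\<lambda>m. \<Prod>j\<in>Poly_Mapping.keys m. g j ^ Poly_Mapping.lookup m j)"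
  by (rule ext) (simp add: zpoly_subst_def frag_extend_def frag_cmul_conv_of_int)

lemma zpoly_subst_0 [simp]: "zpoly_subst g 0 = 0"
  by (simp add: zpoly_subst_eq_frag_extend)

lemma zpoly_subst_1 [simp]: "zpoly_subst g 1 = 1"
  unfolding zpoly_subst_eq_frag_extend single_one[symmetric] frag_extend_of by simp

lemma zpoly_subst_zvar: "zpoly_subst g (zvar j) = g j"
  by (simp add: zpoly_subst_eq_frag_extend zvar_def)

lemma zpoly_subst_add: "zpoly_subst g (p + q) = zpoly_subst g p + zpoly_subst g q"
  by (simp add: zpoly_subst_eq_frag_extend frag_extend_add)

lemma zpoly_subst_diff: "zpoly_subst g (p - q) = zpoly_subst g p - zpoly_subst g q"
  by (simp add: zpoly_subst_eq_frag_extend frag_extend_diff)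

text \<open>Monomials turn addition of exponent vectors into multiplication; the products over
  three different supports become comparable over their common superset, where the added
  factors are \<open>1\<close>.\<close>

lemma prod_keys_add:
  fixes g :: "'a \<Rightarrow> 'b :: comm_semiring_1" and u v :: "'a \<Rightarrow>\<^sub>0 nat"
  shows "(\<Prod>j\<in>Poly_Mapping.keys (u + v). g j ^ Poly_Mapping.lookup (u + v) j) =
         (\<Prod>j\<in>Poly_Mapping.keys u. g j ^ Poly_Mapping.lookup u j) *
         (\<Prod>j\<in>Poly_Mapping.keys v. g j ^ Poly_Mapping.lookup v j)"
proof -
  define A where "A = Poly_Mapping.keys u \<union> Poly_Mapping.keys v"
  have extend: "(\<Prod>j\<in>Poly_Mapping.keys m. g j ^ Poly_Mapping.lookup m j) =
                (\<Prod>j\<in>A. g j ^ Poly_Mapping.lookup m j)"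
    if "Poly_Mapping.keys m \<subseteq> A" for m :: "'a \<Rightarrow>\<^sub>0 nat"
    using that by (intro prod.mono_neutral_left) (auto simp: A_def in_keys_iff)
  have sub: "Poly_Mapping.keys (u + v) \<subseteq> A" "Poly_Mapping.keys u \<subseteq> A" "Poly_Mapping.keys v \<subseteq> A"
    using Poly_Mapping.keys_add[of u v] by (auto simp: A_def)
  show ?thesis
    unfolding sub[THEN extend] by (simp add: lookup_add power_add prod.distrib)
qed

text \<open>Both sides are additive in \<open>p\<close> and in \<open>q\<close>, so it suffices to compare them on
  monomials.\<close>

lemma zpoly_subst_mult: "zpoly_subst g (p * q) = zpoly_subst g p * zpoly_subst g q"
proof -
  have *: "zpoly_subst g (frag_of u * q) = zpoly_subst g (frag_of u) * zpoly_subst g q" for u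
    using subset_UNIV[of "Poly_Mapping.keys q"]
  proof (induction q rule: frag_induction)
    case (one v)
    then show ?case
      by (simp add: mult_single zpoly_subst_eq_frag_extend prod_keys_add)
  qed (simp_all add: zpoly_subst_diff right_diff_distrib)
  show ?thesis
    using subset_UNIV[of "Poly_Mapping.keys p"]
    by (induction p rule: frag_induction)
       (simp_all add: * zpoly_subst_diff left_diff_distrib)
qed

lemma zpoly_subst_power: "zpoly_subst g (p ^ n) = zpoly_subst g p ^ n"
  by (induction n) (simp_all add: zpoly_subst_mult)

section \<open>Iterating the substitution of powers\<close>

definition pow_subst :: "(nat \<Rightarrow> nat) \<Rightarrow> zpoly \<Rightarrow> zpoly" where
  "pow_subst t = zpoly_subst (\<lambda>k. zvar k ^ t k)"

lemma funpow_pow_subst_0 [simp]: "(pow_subst t ^^ i) 0 = 0"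
  by (induction i) (simp_all add: pow_subst_def)

lemma funpow_pow_subst_1 [simp]: "(pow_subst t ^^ i) 1 = 1"
  by (induction i) (simp_all add: pow_subst_def)

lemma funpow_pow_subst_add:
  "(pow_subst t ^^ i) (p + q) = (pow_subst t ^^ i) p + (pow_subst t ^^ i) q"
  by (induction i) (simp_all add: pow_subst_def zpoly_subst_add)

lemma funpow_pow_subst_mult:
  "(pow_subst t ^^ i) (p * q) = (pow_subst t ^^ i) p * (pow_subst t ^^ i) q"
  by (induction i) (simp_all add: pow_subst_def zpoly_subst_mult)

lemma funpow_pow_subst_zvar: "(pow_subst t ^^ i) (zvar j) = zvar j ^ (t j ^ i)"
  by (induction i)
     (simp_all add: pow_subst_def zpoly_subst_power zpoly_subst_zvar flip: power_mult)

section \<open>The functional equation of the generating series\<close>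

lemma fps_nth_compose_X_power:
  fixes f :: "'a :: comm_ring_1 fps"
  assumes "b > 0"
  shows "fps_nth (f oo fps_X ^ b) n = (if b dvd n then fps_nth f (n div b) else 0)"
proof -
  have "fps_nth (f oo fps_X ^ b) n = (\<Sum>i=0..n. if n = b * i then fps_nth f i else 0)"
    unfolding fps_compose_nth by (intro sum.cong) (auto simp flip: power_mult)
  also have "\<dots> = (\<Sum>i\<in>{i\<in>{0..n}. n = b * i}. fps_nth f i)"
    by (rule sum.inter_filter[symmetric]) simp
  also have "{i\<in>{0..n}. n = b * i} = (if b dvd n then {n div b} else {})"
    using assms by auto
  finally show ?thesis by auto
qed

definition stern_series :: "nat \<Rightarrow> (nat \<Rightarrow> nat) \<Rightarrow> nat \<Rightarrow> zpoly fps" where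
  "stern_series b t i = Abs_fps (\<lambda>n. (pow_subst t ^^ i) (stern b t (n + 1)))"

definition stern_factor :: "nat \<Rightarrow> (nat \<Rightarrow> nat) \<Rightarrow> nat \<Rightarrow> zpoly fps" where
  "stern_factor b t i = 1 + (\<Sum>j=1..b. fps_const (zvar j ^ (t j ^ i)) * fps_X ^ j)"

text \<open>The defining equation for indices \<open>b q + 1\<close> also holds for \<open>q = 0\<close>, because \<open>w 0 = 0\<close> and
  \<open>w 1 = 1\<close>. So the coefficients with last digit \<open>0\<close>, the constant one included, obey one
  formula.\<close>

lemma stern_mult_base_Suc:
  assumes "2 \<le> b"
  shows "(pow_subst t ^^ i) (stern b t (b * q + 1)) =
           zvar b ^ (t b ^ i) * (pow_subst t ^^ Suc i) (stern b t q) +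
           (pow_subst t ^^ Suc i) (stern b t (q + 1))"
proof (cases "q = 0")
  case False
  then have "stern b t (b * q + 1) =
      zvar b * pow_subst t (stern b t q) + pow_subst t (stern b t (q + 1))"
    using assms unfolding pow_subst_def by (intro stern.simps) auto
  then show ?thesis
    by (simp only: funpow_pow_subst_add funpow_pow_subst_mult funpow_pow_subst_zvar
          funpow_Suc_right o_apply)
qed (simp del: funpow.simps)

lemma stern_digit:
  assumes "2 \<le> b" "1 \<le> r" "r < b"
  shows "(pow_subst t ^^ i) (stern b t (b * q + r + 1)) =
           zvar r ^ (t r ^ i) * (pow_subst t ^^ Suc i) (stern b t (q + 1))"
proof -
  have "stern b t (b * (q + 1 - 1) + r + 1) = zvar r * pow_subst t (stern b t (q + 1))"
    using assms unfolding pow_subst_def by (intro stern.simps) auto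
  then show ?thesis
    by (simp only: diff_add_inverse2 funpow_pow_subst_mult funpow_pow_subst_zvar
          funpow_Suc_right o_apply)
qed

text \<open>The recursion splits off the last base \<open>b\<close> digit of \<open>n\<close>: composing with \<open>X ^ b\<close> moves the
  coefficients to the multiples of \<open>b\<close>, and the factor fills the gaps. Its degree is \<open>b\<close>,
  not \<open>b - 1\<close>, so neighbouring copies overlap on the multiples of \<open>b\<close>; there the recursion
  has its second summand.\<close>

lemma stern_series_step:
  assumes "2 \<le> b"
  shows "stern_series b t i =
           stern_factor b t i * (stern_series b t (Suc i) oo fps_X ^ b)"
proof (rule fps_ext)
  fix n
  define q r where "q = n div b" and "r = n mod b"
  have n: "n = b * q + r" and r: "r < b"
    using assms by (simp_all add: q_def r_def)
  define c where "c j = zvar j ^ (t j ^ i)" for j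
  define D where "D = stern_series b t (Suc i) oo fps_X ^ b"
  have D: "fps_nth D k =
      (if b dvd k then (pow_subst t ^^ Suc i) (stern b t (k div b + 1)) else 0)" for k
    using assms by (simp add: D_def fps_nth_compose_X_power stern_series_def del: funpow.simps)
  have expand: "fps_nth (stern_factor b t i * D) n =
      fps_nth D n + (\<Sum>j=1..b. if n < j then 0 else c j * fps_nth D (n - j))"
    by (simp add: stern_factor_def c_def distrib_right sum_distrib_right fps_sum_nth
          fps_X_power_mult_nth mult.assoc if_distrib cong: if_cong)
  \<comment> \<open>Modulo \<open>b\<close>, the range \<open>1..b\<close> is a full set of residues, so one summand survives.\<close>
  have dvd_iff: "b dvd n - j \<longleftrightarrow> (if r = 0 then j = b else j = r)"
    if "j \<in> {1..b}" "\<not> n < j" for j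
  proof -
    have "b dvd n - j \<longleftrightarrow> n mod b = j mod b"
      using that by (auto simp: mod_eq_dvd_iff_nat)
    moreover have "j mod b = (if j = b then 0 else j)"
      using that by auto
    ultimately show ?thesis
      using that r by (auto simp flip: r_def)
  qed
  show "fps_nth (stern_series b t i) n =
      fps_nth (stern_factor b t i * (stern_series b t (Suc i) oo fps_X ^ b)) n"
  proof (cases "r = 0")
    case True
    have "(\<Sum>j=1..b. if n < j then 0 else c j * fps_nth D (n - j)) =
          (\<Sum>j\<in>{b}. if n < j then 0 else c j * fps_nth D (n - j))"
      using assms dvd_iff True by (intro sum.mono_neutral_right) (auto simp: D)
    also have "\<dots> = c b * (pow_subst t ^^ Suc i) (stern b t q)"
    \<comment> \<open>For \<open>q = 0\<close> the summand is cut off by \<open>n < b\<close>, in accordance with \<open>w 0 = 0\<close>.\<close>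
    proof (cases q)
      case 0
      then show ?thesis using n True assms by (simp del: funpow.simps)
    next
      case (Suc q')
      then show ?thesis using n True assms by (simp add: D del: funpow.simps)
    qed
    finally have "fps_nth (stern_factor b t i * D) n =
        (pow_subst t ^^ Suc i) (stern b t (q + 1)) + c b * (pow_subst t ^^ Suc i) (stern b t q)"
      unfolding expand using n True assms by (simp add: D del: funpow.simps)
    then show ?thesis
      using n True stern_mult_base_Suc[OF assms, where t = t and i = i and q = q]
      by (simp add: D_def stern_series_def c_def add.commute del: funpow.simps)
  next
    case False
    have "(\<Sum>j=1..b. if n < j then 0 else c j * fps_nth D (n - j)) =
          (\<Sum>j\<in>{r}. if n < j then 0 else c j * fps_nth D (n - j))"
      using r dvd_iff False by (intro sum.mono_neutral_right) (auto simp: D)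
    also have "\<dots> = c r * (pow_subst t ^^ Suc i) (stern b t (q + 1))"
      using n r by (simp add: D del: funpow.simps)
    finally have "fps_nth (stern_factor b t i * D) n =
        c r * (pow_subst t ^^ Suc i) (stern b t (q + 1))"
      unfolding expand using False by (simp add: D r_def mod_eq_0_iff_dvd del: funpow.simps)
    then show ?thesis
      using n False r stern_digit[OF assms, where r = r and t = t and i = i and q = q]
      by (simp add: D_def stern_series_def c_def del: funpow.simps)
  qed
qed

section \<open>Unfolding into the infinite product\<close>

lemma stern_factor_compose:
  assumes "b > 0"
  shows "stern_factor b t i oo fps_X ^ (b ^ i) =
           1 + (\<Sum>j=1..b. fps_const (zvar j ^ (t j ^ i)) * fps_X ^ (j * b ^ i))"
proof -
  have "fps_nth (fps_X ^ (b ^ i)) 0 = (0 :: zpoly)"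
    using assms by simp
  then show ?thesis
    by (simp add: stern_factor_def fps_compose_add_distrib fps_compose_sum_distrib
          fps_compose_mult_distrib fps_X_fps_compose_startby0 mult.commute
          flip: fps_compose_power power_mult)
qed

text \<open>Composition with \<open>X ^ (b ^ N)\<close> is multiplicative, so it carries the functional equation of
  the \<open>N\<close>-th series to the one that extends the product by its next factor.\<close>

lemma stern_series_unfold:
  assumes "2 \<le> b"
  shows "stern_series b t 0 =
           (\<Prod>i<N. stern_factor b t i oo fps_X ^ (b ^ i)) *
           (stern_series b t N oo fps_X ^ (b ^ N))"
proof (induction N)
  case (Suc N)
  have X0: "fps_nth (fps_X ^ (b ^ N)) 0 = (0 :: zpoly)" "fps_nth (fps_X ^ b) 0 = (0 :: zpoly)"
    using assms by simp_all
  have "stern_series b t N oo fps_X ^ (b ^ N) =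
      (stern_factor b t N oo fps_X ^ (b ^ N)) *
      (stern_series b t (Suc N) oo (fps_X ^ b oo fps_X ^ (b ^ N)))"
    using fps_compose_assoc[OF X0, of "stern_series b t (Suc N)"]
    by (subst stern_series_step[OF assms]) (simp add: fps_compose_mult_distrib[OF X0(1)])
  also have "fps_X ^ b oo fps_X ^ (b ^ N) = (fps_X :: zpoly fps) ^ (b ^ Suc N)"
    using X0 by (simp add: fps_X_fps_compose_startby0 mult.commute
        flip: fps_compose_power power_mult)
  finally show ?case
    using Suc by (simp add: mult.assoc)
qed simp

text \<open>The remainder is \<open>1\<close> modulo \<open>X ^ (b ^ N)\<close>, because its constant coefficient is an iterated
  substitution into \<open>w 1 = 1\<close>.\<close>

lemma fps_nth_stern_series_eq_partial_prod:
  assumes "2 \<le> b" "n < b ^ N"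
  shows "fps_nth (\<Prod>i<N. stern_factor b t i oo fps_X ^ (b ^ i)) n = fps_nth (stern_series b t 0) n"
proof -
  define P where "P = (\<Prod>i<N. stern_factor b t i oo fps_X ^ (b ^ i))"
  define R where "R = stern_series b t N oo fps_X ^ (b ^ N)"
  have R: "fps_nth R k = (if k = 0 then 1 else 0)" if "k \<le> n" for k
    using assms that by (auto simp: R_def fps_nth_compose_X_power stern_series_def dest: dvd_imp_le)
  have "fps_nth (P * R) n = (\<Sum>i=0..n. if i = n then fps_nth P i else 0)"
    unfolding fps_mult_nth by (intro sum.cong) (auto simp: R)
  also have "\<dots> = fps_nth P n"
    by simp
  finally show ?thesis
    using stern_series_unfold[OF assms(1), of t N] by (simp add: P_def R_def)
qed

lemma stern_series_has_prod:
  assumes "2 \<le> b"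
  shows "(\<lambda>i. stern_factor b t i oo fps_X ^ (b ^ i)) has_prod stern_series b t 0"
proof -
  have "(\<lambda>N. \<Prod>i\<le>N. stern_factor b t i oo fps_X ^ (b ^ i)) \<longlonglongrightarrow> stern_series b t 0"
  proof (rule tendsto_fpsI)
    fix n
    have "fps_nth (\<Prod>i\<le>N. stern_factor b t i oo fps_X ^ (b ^ i)) n =
        fps_nth (stern_series b t 0) n" if "n \<le> N" for N
    proof -
      have "n < 2 ^ Suc N" using that less_exp[of "Suc N"] by linarith
      also have "2 ^ Suc N \<le> b ^ Suc N" using assms by (intro power_mono) auto
      finally show ?thesis
        using fps_nth_stern_series_eq_partial_prod[OF assms]
        by (simp only: lessThan_Suc_atMost[symmetric])
    qed
    then show "\<forall>\<^sub>F N in sequentially.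
        fps_nth (\<Prod>i\<le>N. stern_factor b t i oo fps_X ^ (b ^ i)) n = fps_nth (stern_series b t 0) n"
      unfolding eventually_sequentially by blast
  qed
  \<comment> \<open>Convergence of an infinite product includes that the limit is not zero; here its
    constant coefficient is \<open>w 1 = 1\<close>.\<close>
  moreover have "fps_nth (stern_series b t 0) 0 \<noteq> 0"
    by (simp add: stern_series_def)
  then have "stern_series b t 0 \<noteq> 0"
    by auto
  ultimately show ?thesis
    by (simp add: has_prod_def raw_has_prod_def)
qed

theorem theorem1:
  fixes b :: nat and t :: "nat \<Rightarrow> nat"
  assumes "b \<ge> 2"
    and "\<And>j. j \<in> {1..b} \<Longrightarrow> t j > 0"
  shows "let F = (\<lambda>i. 1 + (\<Sum>j=1..b. fps_const (zvar j ^ (t j ^ i)) * fps_X ^ (j * b ^ i)))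
         in convergent_prod F \<and>
            Abs_fps (\<lambda>n. if n \<ge> 1 then stern b t n else 0) = fps_X * prodinf F"
proof -
  define F where "F = (\<lambda>i. 1 + (\<Sum>j=1..b. fps_const (zvar j ^ (t j ^ i)) * fps_X ^ (j * b ^ i)))"
  have "F = (\<lambda>i. stern_factor b t i oo fps_X ^ (b ^ i))"
    unfolding F_def using assms(1) by (intro ext stern_factor_compose[symmetric]) simp
  then have F: "F has_prod stern_series b t 0"
    using stern_series_has_prod[OF assms(1)] by simp
  have "Abs_fps (\<lambda>n. if n \<ge> 1 then stern b t n else 0) = fps_X * stern_series b t 0"
    by (rule fps_ext) (simp add: stern_series_def)
  with F have "convergent_prod F \<and>
      Abs_fps (\<lambda>n. if n \<ge> 1 then stern b t n else 0) = fps_X * prodinf F"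
    using has_prod_unique[OF F] by (auto simp: has_prod_def convergent_prod_def)
  then show ?thesis
    by (simp only: Let_def F_def)
qed

end
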